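(* Let $N\ge3$, let $m\geq 1$ be an integer, let $T$ be a $C^1$ functional on $H^m(\mathbb{R}^N)$, let $\rho>0$, and let $\{u_n\}\subset B_\rho$ be a minimizing sequence for $I_\rho$ such that $u_n\rightharpoonup\bar u\neq0$ weakly in $H^m(\mathbb{R}^N)$; set $\mu=\|\bar u\|_2\in(0,\rho]$. Assume that $$T(u_n-\bar u)+T(\bar u)=T(u_n)+o(1),$$ $$T(\alpha_n(u_n-\bar u))-T(u_n-\bar u)=o(1),\qquad\text{where }\alpha_n=\frac{\sqrt{\rho^2-\mu^2}}{\|u_n-\bar u\|_2},$$ and finally that $$I_\rho<I_{\mu'}+I_{\sqrt{\rho^2-\mu'^2}}\quad\text{for any }0<\mu'<\rho .$$ Then $\bar u\in B_\rho$. Moreover, if, as $n,k\to+\infty$, $$\langle T'(u_n)-T'(u_k),u_n-u_k\rangle=o(1)\qquad\text{and}\qquad\langle T'(u_n),u_n\rangle=O(1),$$ then $\|u_n-\bar u\|_{H^m(\mathbb{R}^N)}\to0$.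
   Context: Functions are complex-valued. $\|\cdot\|_2$ is the $L^2(\mathbb{R}^N)$ norm, $$\|u\|_{D^{m,2}}^2=\sum_{\alpha_1+\dots+\alpha_N=m}\int_{\mathbb{R}^N}|D^\alpha u|^2dx,\quad \alpha\in\mathbb{N}^N,\ D^\alpha=\partial_{x_1}^{\alpha_1}\cdots\partial_{x_N}^{\alpha_N},$$ and $\|u\|_{H^m}^2=\|u\|_{D^{m,2}}^2+\|u\|_2^2$. For $\rho>0$, $B_\rho=\{u\in H^m(\mathbb{R}^N):\|u\|_2=\rho\}$, $$I(u)=\frac12\|u\|_{D^{m,2}}^2+T(u),\qquad I_\rho=\inf_{B_\rho}I .$$ A minimizing sequence for $I_\rho$ is a sequence $\{u_n\}\subset B_\rho$ with $I(u_n)\to I_\rho$. $\langle\cdot,\cdot\rangle$ denotes the duality pairing between $H^m(\mathbb{R}^N)$ and its dual; $o(1)$ denotes a quantity tending to $0$ and $O(1)$ a bounded sequence. *)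

theory Defs
  imports "HOL-Analysis.Analysis"
begin

type_synonym 'n cfun = "real ^ 'n \<Rightarrow> complex"

section \<open>Partial derivatives and test functions\<close>

definition partial :: "'n::finite \<Rightarrow> 'n cfun \<Rightarrow> 'n cfun" where
  "partial i f = (\<lambda>x. frechet_derivative f (at x) (axis i 1))"

definition multi_order :: "('n::finite \<Rightarrow> nat) \<Rightarrow> nat" where
  "multi_order \<alpha> = (\<Sum>i\<in>UNIV. \<alpha> i)"

text \<open>An enumeration of the coordinates. It only fixes the order in which partial derivatives
  are taken; \<open>mderiv\<close> is applied to smooth functions, for which this order is irrelevant.\<close>

definition coords :: "'n::finite list" where
  "coords = (SOME is. distinct is \<and> set is = UNIV)"

definition mderiv :: "('n::finite \<Rightarrow> nat) \<Rightarrow> 'n cfun \<Rightarrow> 'n cfun" where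
  "mderiv \<alpha> f = foldr (\<lambda>i. partial i ^^ \<alpha> i) coords f"

text \<open>Smoothness: every iterated partial derivative, of any order and in any sequence of
  directions, is (Frechet) differentiable, hence also continuous.\<close>

definition smooth :: "'n::finite cfun \<Rightarrow> bool" where
  "smooth f \<longleftrightarrow> (\<forall>is x. foldr partial is f differentiable (at x))"

definition test_functions :: "'n::finite cfun set" where
  "test_functions = {\<phi>. smooth \<phi> \<and> compact (closure {x. \<phi> x \<noteq> 0})}"

section \<open>Weak derivatives and Sobolev spaces\<close>

text \<open>Elements of the function spaces are represented by functions, not by classes modulo
  equality almost everywhere; the norms below are accordingly seminorms, vanishing exactly on
  the functions that are zero almost everywhere.\<close>

definition locally_integrable :: "'n::finite cfun \<Rightarrow> bool" where
  "locally_integrable f \<longleftrightarrow> (\<forall>K. compact K \<longrightarrow> f absolutely_integrable_on K)"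

definition has_weak_deriv :: "'n::finite cfun \<Rightarrow> ('n \<Rightarrow> nat) \<Rightarrow> 'n cfun \<Rightarrow> bool" where
  "has_weak_deriv u \<alpha> g \<longleftrightarrow> locally_integrable u \<and> locally_integrable g \<and>
     (\<forall>\<phi>\<in>test_functions.
        (LINT x|lebesgue. u x * mderiv \<alpha> \<phi> x)
          = (- 1) ^ multi_order \<alpha> * (LINT x|lebesgue. g x * \<phi> x))"

text \<open>A representative of the weak derivative, which is unique up to equality almost
  everywhere.\<close>

definition weak_deriv :: "('n::finite \<Rightarrow> nat) \<Rightarrow> 'n cfun \<Rightarrow> 'n cfun" where
  "weak_deriv \<alpha> u = (SOME g. has_weak_deriv u \<alpha> g)"

definition L2 :: "'n::finite cfun set" where
  "L2 = {u. u \<in> borel_measurable lebesgue \<and> integrable lebesgue (\<lambda>x. (cmod (u x))\<^sup>2)}"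

definition sobolev :: "nat \<Rightarrow> 'n::finite cfun set" where
  "sobolev m = {u \<in> L2. \<forall>\<alpha>. multi_order \<alpha> \<le> m \<longrightarrow> (\<exists>g\<in>L2. has_weak_deriv u \<alpha> g)}"

definition norm_L2 :: "'n::finite cfun \<Rightarrow> real" where
  "norm_L2 u = sqrt (LINT x|lebesgue. (cmod (u x))\<^sup>2)"

definition norm_D :: "nat \<Rightarrow> 'n::finite cfun \<Rightarrow> real" where
  "norm_D m u = sqrt (\<Sum>\<alpha> | multi_order \<alpha> = m. LINT x|lebesgue. (cmod (weak_deriv \<alpha> u x))\<^sup>2)"

definition norm_H :: "nat \<Rightarrow> 'n::finite cfun \<Rightarrow> real" where
  "norm_H m u = sqrt ((norm_D m u)\<^sup>2 + (norm_L2 u)\<^sup>2)"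

section \<open>Dual space, weak convergence, continuously differentiable functionals\<close>

text \<open>The dual of \<open>sobolev m\<close> as a real normed space, as appropriate for differentials of
  real-valued functionals. Its real-linear functionals are the real parts of the complex-linear
  ones, so it gives the usual weak convergence. The bound makes each functional independent
  of the choice of representatives.\<close>

definition sobolev_dual :: "nat \<Rightarrow> ('n::finite cfun \<Rightarrow> real) set" where
  "sobolev_dual m = {l.
     (\<forall>u\<in>sobolev m. \<forall>v\<in>sobolev m. \<forall>a b.
        l (\<lambda>x. a *\<^sub>R u x + b *\<^sub>R v x) = a * l u + b * l v) \<and>
     (\<exists>C. \<forall>u\<in>sobolev m. \<bar>l u\<bar> \<le> C * norm_H m u)}"

definition weakly_converges :: "nat \<Rightarrow> (nat \<Rightarrow> 'n::finite cfun) \<Rightarrow> 'n cfun \<Rightarrow> bool" where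
  "weakly_converges m u v \<longleftrightarrow> (\<forall>n. u n \<in> sobolev m) \<and> v \<in> sobolev m \<and>
     (\<forall>l\<in>sobolev_dual m. (\<lambda>n. l (u n)) \<longlonglongrightarrow> l v)"

text \<open>Frechet differentiability. The non-strict bound, required also when
  \<open>norm_H m (v - u) = 0\<close>, forces \<open>T\<close> to respect equality almost everywhere.\<close>

definition has_sobolev_deriv ::
  "nat \<Rightarrow> ('n::finite cfun \<Rightarrow> real) \<Rightarrow> ('n cfun \<Rightarrow> real) \<Rightarrow> 'n cfun \<Rightarrow> bool" where
  "has_sobolev_deriv m T l u \<longleftrightarrow> l \<in> sobolev_dual m \<and>
     (\<forall>\<epsilon>>0. \<exists>\<delta>>0. \<forall>v\<in>sobolev m. norm_H m (\<lambda>x. v x - u x) < \<delta> \<longrightarrow>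
        \<bar>T v - T u - l (\<lambda>x. v x - u x)\<bar> \<le> \<epsilon> * norm_H m (\<lambda>x. v x - u x))"

text \<open>\<open>T\<close> is of class \<open>C\<^sup>1\<close> with differential \<open>T'\<close>, which is continuous with respect to the
  operator norm; the pairing of \<open>T' u\<close> with \<open>v\<close> is \<open>T' u v\<close>.\<close>

definition C1_functional ::
  "nat \<Rightarrow> ('n::finite cfun \<Rightarrow> real) \<Rightarrow> ('n cfun \<Rightarrow> 'n cfun \<Rightarrow> real) \<Rightarrow> bool" where
  "C1_functional m T T' \<longleftrightarrow>
     (\<forall>u\<in>sobolev m. has_sobolev_deriv m T (T' u) u) \<and>
     (\<forall>u\<in>sobolev m. \<forall>\<epsilon>>0. \<exists>\<delta>>0. \<forall>v\<in>sobolev m. norm_H m (\<lambda>x. v x - u x) < \<delta> \<longrightarrow>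
        (\<forall>h\<in>sobolev m. \<bar>T' v h - T' u h\<bar> \<le> \<epsilon> * norm_H m h))"

section \<open>The constrained minimization problem\<close>

definition L2_sphere :: "nat \<Rightarrow> real \<Rightarrow> 'n::finite cfun set" where
  "L2_sphere m \<rho> = {u \<in> sobolev m. norm_L2 u = \<rho>}"

definition energy :: "nat \<Rightarrow> ('n::finite cfun \<Rightarrow> real) \<Rightarrow> 'n cfun \<Rightarrow> real" where
  "energy m T u = 1 / 2 * (norm_D m u)\<^sup>2 + T u"

text \<open>The infimum is taken in the extended reals, since the functional need not be bounded
  below on the sphere.\<close>

definition inf_energy :: "nat \<Rightarrow> ('n::finite cfun \<Rightarrow> real) \<Rightarrow> real \<Rightarrow> ereal" where
  "inf_energy m T \<rho> = (INF u\<in>L2_sphere m \<rho>. ereal (energy m T u))"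

definition minimizing_sequence ::
  "nat \<Rightarrow> ('n::finite cfun \<Rightarrow> real) \<Rightarrow> real \<Rightarrow> (nat \<Rightarrow> 'n cfun) \<Rightarrow> bool" where
  "minimizing_sequence m T \<rho> u \<longleftrightarrow> (\<forall>n. u n \<in> L2_sphere m \<rho>) \<and>
     (\<lambda>n. ereal (energy m T (u n))) \<longlonglongrightarrow> inf_energy m T \<rho>"

end

theory Submission
  imports Defs
begin

text \<open>
  Put \<open>v\<^sub>n = u\<^sub>n - ubar\<close>. Weak convergence splits both squared norms of \<open>u\<^sub>n\<close>, so
  \<open>I(u\<^sub>n) = I(v\<^sub>n) + I(ubar) + o(1)\<close>. If \<open>\<mu> < \<rho>\<close>, then \<open>\<alpha>\<^sub>n\<close> tends to \<open>1\<close>, and as \<open>v\<^sub>n\<close> is bounded,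
  \<open>v\<^sub>n\<close> may be replaced by \<open>\<alpha>\<^sub>n v\<^sub>n\<close>, which lies on the sphere of radius \<open>sqrt (\<rho>\<^sup>2 - \<mu>\<^sup>2)\<close>; this
  contradicts strict subadditivity. Hence \<open>\<mu> = \<rho>\<close>, so that \<open>\<alpha>\<^sub>n = 0\<close> and the rescaling hypothesis
  says that \<open>T(v\<^sub>n)\<close> tends to \<open>T(0)\<close>. Thus \<open>I(u\<^sub>n)\<close> is half the squared Dirichlet norm of \<open>v\<^sub>n\<close> plus
  \<open>T(0) + I(ubar) + o(1)\<close>, while subadditivity on the pieces \<open>s ubar\<close> and \<open>sqrt (1 - s\<^sup>2) ubar\<close>
  gives \<open>T(0) + I(ubar)\<close> as an upper bound of the infimum when \<open>s\<close> tends to \<open>0\<close>. So \<open>v\<^sub>n\<close> tends to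
  \<open>0\<close> in norm.
\<close>

subsection \<open>Bump functions\<close>

text \<open>Allowing every polynomial in \<open>1 / t\<close> gives a family that is closed under
  differentiation. \<open>bump 1\<close> is the classical smooth function that is flat at 0.\<close>

definition bump :: "real poly \<Rightarrow> real \<Rightarrow> real" where
  "bump p t = (if t > 0 then poly p (1 / t) * exp (- 1 / t) else 0)"

lemma poly_exp_neg_tendsto_0: "((\<lambda>s::real. poly p s * exp (- s)) \<longlongrightarrow> 0) at_top"
proof -
  have "((\<lambda>s::real. \<Sum>i\<le>degree p. coeff p i * (s ^ i / exp s)) \<longlongrightarrow> (\<Sum>i\<le>degree p. coeff p i * 0)) at_top"
    by (intro tendsto_sum tendsto_mult tendsto_const tendsto_power_div_exp_0)
  then show ?thesis
    by (simp add: poly_altdef sum_distrib_right exp_minus divide_inverse mult.assoc)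
qed

lemma bump_tendsto_0: "(bump p \<longlongrightarrow> 0) (at 0)"
proof (rule filterlim_split_at)
  show "(bump p \<longlongrightarrow> 0) (at_left 0)"
    by (rule tendsto_eventually)
      (auto simp: bump_def eventually_at_filter intro!: always_eventually)
  have "((\<lambda>t::real. poly p (inverse t) * exp (- inverse t)) \<longlongrightarrow> 0) (at_right 0)"
    by (rule filterlim_compose[OF poly_exp_neg_tendsto_0 filterlim_inverse_at_top_right])
  then show "(bump p \<longlongrightarrow> 0) (at_right 0)"
    by (rule Lim_transform_eventually)
      (auto simp: bump_def eventually_at_filter field_simps intro!: always_eventually)
qed

text \<open>In the variable s = 1 / t, d/dt is -s^2 d/ds, and d/ds turns p(s) exp(-s) into (p' -
  p)(s) exp(-s). This yields the polynomial s^2 (p - p'), where \<open>[:0, 0, 1:]\<close> stands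
  for s^2.\<close>

lemma bump_has_real_derivative:
  "(bump p has_real_derivative bump ([:0, 0, 1:] * (p - pderiv p)) t) (at t)"
proof (cases t "0::real" rule: linorder_cases)
  case less
  have "((\<lambda>_. 0) has_real_derivative 0) (at t)"
    by simp
  moreover have "open {..<0::real}" by simp
  ultimately have "(bump p has_real_derivative 0) (at t)"
    by (rule has_field_derivative_transform_within_open[where S = "{..<0}"])
       (use less in \<open>auto simp: bump_def\<close>)
  then show ?thesis using less by (simp add: bump_def)
next
  case greater
  have "((\<lambda>t. poly p (1 / t) * exp (- 1 / t)) has_real_derivative
          bump ([:0, 0, 1:] * (p - pderiv p)) t) (at t)"
    using greater unfolding bump_def
    by (auto intro!: derivative_eq_intros DERIV_chain'[where g = "poly p"]
        simp: field_simps power2_eq_square)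
  moreover have "open {0::real<..}" by simp
  ultimately show ?thesis
    by (rule has_field_derivative_transform_within_open[where S = "{0<..}"])
       (use greater in \<open>auto simp: bump_def\<close>)
next
  case equal
  \<comment> \<open>Dividing by \<open>h\<close> multiplies the polynomial by 1 / h, so the
    difference quotient at 0 is again a member of the family and tends to 0.\<close>
  have "(\<lambda>h. (bump p (0 + h) - bump p 0) / h) = bump (pCons 0 p)"
    by (auto simp: bump_def fun_eq_iff)
  then have "(bump p has_real_derivative 0) (at 0)"
    using bump_tendsto_0[of "pCons 0 p"] by (simp add: DERIV_def)
  then show ?thesis using equal by (simp add: bump_def)
qed

lemma bump_one: "bump 1 t = (if t > 0 then exp (- 1 / t) else 0)"
  by (simp add: bump_def)

lemma bump_one_bounds: "0 \<le> bump 1 t" "bump 1 t \<le> 1"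
  by (auto simp: bump_one)

lemma bump_one_scaled_tendsto:
  assumes "t > 0"
  shows "(\<lambda>j. bump 1 (real (Suc j) * t)) \<longlonglongrightarrow> 1"
proof -
  have "(\<lambda>j. exp (- (1 / t) * inverse (real (Suc j)))) \<longlonglongrightarrow> exp (- (1 / t) * 0)"
    by (intro tendsto_intros LIMSEQ_inverse_real_of_nat)
  moreover have "bump 1 (real (Suc j) * t) = exp (- (1 / t) * inverse (real (Suc j)))" for j
  proof -
    have "0 < real (Suc j) * t" using assms by simp
    then show ?thesis by (simp add: bump_one divide_inverse del: of_nat_Suc)
  qed
  ultimately show ?thesis by simp
qed

text \<open>An algebra of explicit functions that is closed under partial derivatives, so that
  its elements are smooth in the sense of iterated partial derivatives.\<close>

inductive_set bump_algebra :: "'n::finite cfun set" where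
  const: "(\<lambda>x. c) \<in> bump_algebra"
| bump: "(\<lambda>x. of_real (bump p (a * x $ i + b))) \<in> bump_algebra"
| add: "f \<in> bump_algebra \<Longrightarrow> g \<in> bump_algebra \<Longrightarrow> (\<lambda>x. f x + g x) \<in> bump_algebra"
| mult: "f \<in> bump_algebra \<Longrightarrow> g \<in> bump_algebra \<Longrightarrow> (\<lambda>x. f x * g x) \<in> bump_algebra"

lemma partial_eq: "(f has_derivative f') (at x) \<Longrightarrow> partial i f x = f' (axis i 1)"
  unfolding partial_def by (simp flip: frechet_derivative_at)

text \<open>Both claims go through a single induction because the sum and product rules for
  \<open>partial j\<close> require the components to be differentiable. A generator differentiates
  to another generator times a constant.\<close>

lemma bump_algebra_differentiable:
  fixes f :: "'n::finite cfun"
  shows "f \<in> bump_algebra \<Longrightarrow> (\<forall>x. f differentiable (at x)) \<and> (\<forall>j. partial j f \<in> bump_algebra)"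
proof (induction rule: bump_algebra.induct)
  case (const c)
  have "partial j (\<lambda>x::real^'n. c) = (\<lambda>x. 0)" for j
    by (rule ext, subst partial_eq[OF has_derivative_const]) simp
  then show ?case by (simp add: bump_algebra.const)
next
  case (bump p a i b)
  let ?q = "[:0, 0, 1:] * (p - pderiv p)"
  have d: "((\<lambda>x::real^'n. of_real (bump p (a * x $ i + b)) :: complex) has_derivative
        (\<lambda>h. of_real (bump ?q (a * x $ i + b) * (a * h $ i)))) (at x)" for x
  proof -
    have "((\<lambda>x::real^'n. a * x $ i + b) has_derivative (\<lambda>h. a * h $ i)) (at x)"
      by (auto intro!: derivative_eq_intros bounded_linear_imp_has_derivative bounded_linear_intros)
    from has_derivative_compose[OF this bump_has_real_derivative[THEN has_field_derivative_imp_has_derivative]]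
    have "((\<lambda>x::real^'n. bump p (a * x $ i + b)) has_derivative
        (\<lambda>h. bump ?q (a * x $ i + b) * (a * h $ i))) (at x)" by simp
    from has_derivative_of_real[OF this] show ?thesis .
  qed
  have "partial j (\<lambda>x::real^'n. of_real (bump p (a * x $ i + b)) :: complex) =
     (\<lambda>x. of_real (bump ?q (a * x $ i + b)) * of_real (a * axis j 1 $ i))" for j
    by (rule ext, subst partial_eq[OF d]) simp
  then show ?case
    using d by (auto intro!: bump_algebra.intros simp: differentiable_def simp del: mult_pCons_left)
next
  case (add f g)
  have "partial j (\<lambda>x. f x + g x) = (\<lambda>x. partial j f x + partial j g x)" for j
    using add.IH by (intro ext partial_eq[OF has_derivative_add, THEN trans])
      (auto simp: partial_def frechet_derivative_works)
  then show ?case using add by (auto intro: bump_algebra.intros)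
next
  case (mult f g)
  have "partial j (\<lambda>x. f x * g x) = (\<lambda>x. f x * partial j g x + partial j f x * g x)" for j
    using mult.IH by (intro ext partial_eq[OF has_derivative_mult, THEN trans])
      (auto simp: partial_def frechet_derivative_works)
  then show ?case using mult by (auto intro!: bump_algebra.intros)
qed

lemma smooth_bump_algebra:
  assumes "f \<in> bump_algebra"
  shows "smooth f"
proof -
  have "foldr partial is f \<in> bump_algebra" for "is"
    by (induction "is") (use assms bump_algebra_differentiable in auto)
  then show ?thesis
    unfolding smooth_def using bump_algebra_differentiable by blast
qed

lemma bump_algebra_prod:
  "(\<And>i. i \<in> I \<Longrightarrow> f i \<in> bump_algebra) \<Longrightarrow> (\<lambda>x. \<Prod>i\<in>I. f i x) \<in> bump_algebra"
  by (induction I rule: infinite_finite_induct) (auto intro: bump_algebra.intros)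

text \<open>A smooth approximation from below of the indicator of the open box: some factor vanishes
  at each point outside, and the growing steepness \<open>Suc j\<close> drives every factor to 1
  inside.\<close>

definition box_bump :: "real ^ 'n::finite \<Rightarrow> real ^ 'n \<Rightarrow> nat \<Rightarrow> 'n cfun" where
  "box_bump a b j x =
     (\<Prod>i\<in>UNIV. of_real (bump 1 (real (Suc j) * (x $ i - a $ i)))
        * of_real (bump 1 (real (Suc j) * (b $ i - x $ i))))"

lemma box_bump_outside:
  assumes "x \<notin> box a b"
  shows "box_bump a b j x = 0"
proof -
  obtain i where "x $ i \<le> a $ i \<or> b $ i \<le> x $ i"
    using assms by (auto simp: mem_box_cart not_less)
  then have "bump 1 (real (Suc j) * (x $ i - a $ i)) = 0 \<or>
      bump 1 (real (Suc j) * (b $ i - x $ i)) = 0"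
    by (auto simp: bump_one zero_less_mult_iff)
  then show ?thesis unfolding box_bump_def by (intro prod_zero) auto
qed

lemma box_bump_in_test_functions: "box_bump a b j \<in> test_functions"
proof -
  have "(\<lambda>x. of_real (bump 1 (real (Suc j) * x $ i + (- real (Suc j) * a $ i)))
        * of_real (bump 1 ((- real (Suc j)) * x $ i + real (Suc j) * b $ i))) \<in> bump_algebra" for i
    by (intro bump_algebra.intros)
  then have "box_bump a b j \<in> bump_algebra"
    unfolding box_bump_def[abs_def] by (intro bump_algebra_prod) (simp add: algebra_simps)
  moreover have "closure {x. box_bump a b j x \<noteq> 0} \<subseteq> cbox a b"
    by (rule closure_minimal) (use box_bump_outside box_subset_cbox in blast)+
  then have "compact (closure {x. box_bump a b j x \<noteq> 0})"
    using compact_cbox closed_closure by (metis compact_Int_closed inf.absorb_iff2 inf_commute)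
  ultimately show ?thesis
    by (simp add: test_functions_def smooth_bump_algebra)
qed

lemma norm_box_bump_le: "norm (box_bump a b j x) \<le> indicator (box a b) x"
proof (cases "x \<in> box a b")
  case True
  have "norm (box_bump a b j x) \<le> 1"
    unfolding box_bump_def prod_norm[symmetric]
    by (intro prod_le_1) (auto simp: norm_mult bump_one_bounds mult_le_one)
  then show ?thesis using True by simp
qed (simp add: box_bump_outside)

lemma box_bump_tendsto: "(\<lambda>j. box_bump a b j x) \<longlonglongrightarrow> indicator (box a b) x"
proof (cases "x \<in> box a b")
  case True
  have *: "(\<lambda>j. of_real (bump 1 (real (Suc j) * (x $ i - a $ i)))
        * of_real (bump 1 (real (Suc j) * (b $ i - x $ i))) :: complex) \<longlonglongrightarrow> of_real 1 * of_real 1" for i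
    using True by (intro tendsto_mult tendsto_of_real bump_one_scaled_tendsto)
      (auto simp: mem_box_cart)
  have "(\<lambda>j. box_bump a b j x) \<longlonglongrightarrow> (\<Prod>i\<in>(UNIV::'a set). of_real 1 * of_real 1)"
    unfolding box_bump_def by (intro tendsto_prod *)
  then show ?thesis using True by simp
qed (simp add: box_bump_outside)

subsection \<open>Test functions\<close>

lemma test_function_partial:
  assumes "\<phi> \<in> test_functions"
  shows "partial i \<phi> \<in> test_functions"
proof -
  have sm: "smooth \<phi>" and co: "compact (closure {x. \<phi> x \<noteq> 0})"
    using assms by (auto simp: test_functions_def)
  \<comment> \<open>\<open>foldr\<close> applies the last direction of the list first, so this is
    smoothness of \<open>\<phi>\<close> along the list \<open>is @ [i]\<close>.\<close>
  have "foldr partial is (partial i \<phi>) differentiable at x" for "is" x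
    using sm[unfolded smooth_def, rule_format, of "is @ [i]" x] by simp
  then have "smooth (partial i \<phi>)" by (simp add: smooth_def)
  \<comment> \<open>The complement of the closed support is open and \<open>\<phi>\<close> vanishes
    on it, so the derivative vanishes there too and the support does not grow.\<close>
  moreover have "partial i \<phi> x = 0" if "x \<notin> closure {x. \<phi> x \<noteq> 0}" for x
  proof -
    have "(\<phi> has_derivative (\<lambda>_. 0)) (at x)"
      by (rule has_derivative_transform_within_open[of "\<lambda>_. 0" _ _ _ "- closure {x. \<phi> x \<noteq> 0}"])
        (use that closure_subset[of "{x. \<phi> x \<noteq> 0}"] in auto)
    then show ?thesis by (subst partial_eq) auto
  qed
  then have "closure {x. partial i \<phi> x \<noteq> 0} \<subseteq> closure {x. \<phi> x \<noteq> 0}"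
    by (intro closure_minimal) auto
  then have "compact (closure {x. partial i \<phi> x \<noteq> 0})"
    using co by (metis compact_Int_closed closed_closure inf.absorb_iff2 inf_commute)
  ultimately show ?thesis by (simp add: test_functions_def)
qed

text \<open>This makes \<open>u x * mderiv \<alpha> \<phi> x\<close> integrable for locally
  integrable \<open>u\<close>, so that the defining identity of weak derivatives can be split
  linearly in \<open>u\<close>.\<close>

lemma test_function_mderiv:
  assumes "\<phi> \<in> test_functions"
  shows "mderiv \<alpha> \<phi> \<in> test_functions"
proof -
  have pow: "(partial i ^^ k) f \<in> test_functions" if "f \<in> test_functions" for i k and f :: "'a cfun"
    using that by (induction k) (auto intro: test_function_partial)
  have "foldr (\<lambda>i. partial i ^^ \<alpha> i) is \<phi> \<in> test_functions" for "is"
    by (induction "is") (auto intro: pow assms)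
  then show ?thesis by (simp add: mderiv_def)
qed

lemma test_function_continuous:
  assumes "\<phi> \<in> test_functions"
  shows "continuous_on S \<phi>"
proof -
  have "\<phi> differentiable at x" for x
    using assms smooth_def[of \<phi>] by (auto simp: test_functions_def dest: spec[of _ "[]"])
  then show ?thesis
    by (meson continuous_at_imp_continuous_on differentiable_imp_continuous_within)
qed

text \<open>On the compact support, \<open>f\<close> is absolutely integrable and the continuous
  \<open>\<phi>\<close> is bounded; outside it the product is zero.\<close>

lemma integrable_mult_test_function:
  assumes f: "locally_integrable f" and \<phi>: "\<phi> \<in> test_functions"
  shows "integrable lebesgue (\<lambda>x. f x * \<phi> x)"
proof -
  let ?K = "closure {x. \<phi> x \<noteq> 0}"
  have K: "compact ?K" using \<phi> by (simp add: test_functions_def)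
  then have f': "set_integrable lebesgue ?K f" using f by (simp add: locally_integrable_def)
  have "compact (\<phi> ` ?K)"
    using K test_function_continuous[OF \<phi>] by (rule compact_continuous_image[rotated])
  then obtain B where B: "\<And>x. x \<in> ?K \<Longrightarrow> norm (\<phi> x) \<le> B"
    by (meson bounded_iff compact_imp_bounded imageI)
  have meas: "\<phi> \<in> borel_measurable lebesgue"
    using test_function_continuous[OF \<phi>, of UNIV]
    by (intro measurable_completion) (simp add: borel_measurable_continuous_onI)
  have eq: "f x * \<phi> x = (indicator ?K x *\<^sub>R f x) * \<phi> x" for x
    using closure_subset[of "{x. \<phi> x \<noteq> 0}"] by (auto simp: indicator_def)
  show ?thesis
    unfolding eq
  proof (rule Bochner_Integration.integrable_bound)
    show "integrable lebesgue (\<lambda>x. B *\<^sub>R (indicator ?K x *\<^sub>R f x))"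
      using f' unfolding set_integrable_def by (rule integrable_scaleR_right)
    show "(\<lambda>x. (indicator ?K x *\<^sub>R f x) * \<phi> x) \<in> borel_measurable lebesgue"
      using f' meas by (intro borel_measurable_times) (auto simp: set_integrable_def)
    show "AE x in lebesgue. norm ((indicator ?K x *\<^sub>R f x) * \<phi> x) \<le> norm (B *\<^sub>R (indicator ?K x *\<^sub>R f x))"
    proof (rule AE_I2)
      fix x
      show "norm ((indicator ?K x *\<^sub>R f x) * \<phi> x) \<le> norm (B *\<^sub>R (indicator ?K x *\<^sub>R f x))"
        using B[of x] norm_ge_zero[of "\<phi> x"]
        by (cases "x \<in> ?K") (auto simp: norm_mult mult.commute[of "norm (f x)"] intro!: mult_right_mono)
    qed
  qed
qed

subsection \<open>Weak derivatives\<close>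

text \<open>The fundamental lemma of the calculus of variations. Box bumps converge to the indicator
  of a box, so dominated convergence makes the integral of \<open>f\<close> over every box zero;
  Lebesgue differentiation along shrinking cubes then recovers \<open>f x\<close> off a negligible
  set.\<close>

lemma AE_zero_if_test_integrals_zero:
  fixes f :: "'n::finite cfun"
  assumes f: "locally_integrable f"
    and zero: "\<And>\<phi>. \<phi> \<in> test_functions \<Longrightarrow> (LINT x|lebesgue. f x * \<phi> x) = 0"
  shows "AE x in lebesgue. f x = 0"
proof -
  have fc: "set_integrable lebesgue (cbox a b) f" for a b
    using f by (simp add: locally_integrable_def)
  have fb: "set_integrable lebesgue (box a b) f" for a b
    by (rule set_integrable_subset[OF fc[of a b]]) (auto simp: box_subset_cbox)
  have int0: "integral (cbox a b) f = 0" for a b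
  proof -
    have "(\<lambda>j. LINT x|lebesgue. f x * box_bump a b j x) \<longlonglongrightarrow>
        (LINT x|lebesgue. f x * indicator (box a b) x)"
    proof (rule integral_dominated_convergence)
      show "integrable lebesgue (\<lambda>x. norm (indicator (box a b) x *\<^sub>R f x))"
        using fb by (intro integrable_norm) (simp add: set_integrable_def)
      have "(\<lambda>x. indicator (box a b) x *\<^sub>R f x) \<in> borel_measurable lebesgue"
        using fb by (auto simp: set_integrable_def)
      then show "(\<lambda>x. f x * indicator (box a b) x) \<in> borel_measurable lebesgue"
        by (rule back_subst[of "\<lambda>g. g \<in> _"]) (auto simp: indicator_def)
      show "(\<lambda>x. f x * box_bump a b j x) \<in> borel_measurable lebesgue" for j
        using integrable_mult_test_function[OF f box_bump_in_test_functions] by auto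
      show "AE x in lebesgue. (\<lambda>j. f x * box_bump a b j x) \<longlonglongrightarrow> f x * indicator (box a b) x"
        by (intro AE_I2 tendsto_intros box_bump_tendsto)
      show "AE x in lebesgue. norm (f x * box_bump a b j x) \<le> norm (indicator (box a b) x *\<^sub>R f x)" for j
      proof (rule AE_I2)
        fix x
        show "norm (f x * box_bump a b j x) \<le> norm (indicator (box a b) x *\<^sub>R f x)"
          using mult_left_mono[OF norm_box_bump_le[of a b j x] norm_ge_zero[of "f x"]]
          by (simp add: norm_mult mult.commute)
      qed
    qed
    then have "(LINT x|lebesgue. f x * indicator (box a b) x) = 0"
      using zero[OF box_bump_in_test_functions] by (simp add: LIMSEQ_const_iff)
    moreover have "(LINT x:box a b|lebesgue. f x) = (LINT x|lebesgue. f x * indicator (box a b) x)"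
      unfolding set_lebesgue_integral_def by (rule Bochner_Integration.integral_cong) (auto simp: indicator_def)
    ultimately show ?thesis
      using set_lebesgue_integral_eq_integral(2)[OF fb[of a b]] by (simp add: integral_open_interval)
  qed
  have "f integrable_on cbox a b" for a b
    using set_lebesgue_integral_eq_integral(1)[OF fc] .
  then obtain N where N: "negligible N"
    "\<And>x e. \<lbrakk>x \<notin> N; 0 < e\<rbrakk> \<Longrightarrow> \<exists>d>0. \<forall>h. 0 < h \<and> h < d \<longrightarrow>
        norm (integral (cbox x (x + h *\<^sub>R One)) f /\<^sub>R h ^ DIM(real ^ 'n) - f x) < e"
    using integrable_ccontinuous_explicit by blast
  have "f x = 0" if "x \<notin> N" for x
  proof (rule ccontr)
    assume "f x \<noteq> 0"
    \<comment> \<open>All averages are zero, so with tolerance \<open>norm (f x)\<close> the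
      estimate would read \<open>norm (f x) < norm (f x)\<close>. Hence no \<open>h\<close> could
      lie between 0 and \<open>d\<close>.\<close>
    then have "\<exists>d>0. \<forall>h::real. 0 < h \<longrightarrow> \<not> h < d"
      using N(2)[OF that, of "norm (f x)"] by (auto simp: int0)
    then show False using dense by blast
  qed
  moreover have "AE x in lebesgue. x \<notin> N"
    using N(1) by (simp add: AE_not_in negligible_iff_null_sets)
  ultimately show ?thesis by (auto elim: eventually_mono)
qed

lemma locally_integrable_lincomb:
  "locally_integrable f \<Longrightarrow> locally_integrable g \<Longrightarrow>
    locally_integrable (\<lambda>x. a *\<^sub>R f x + b *\<^sub>R g x)"
  unfolding locally_integrable_def
  by (intro allI impI set_integral_add(1) set_integrable_scaleR_right) auto

text \<open>The integrals of \<open>g\<close> and \<open>h\<close> against a test function are both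
  determined by \<open>u\<close>, so the fundamental lemma applies to the difference.\<close>

lemma has_weak_deriv_unique:
  assumes "has_weak_deriv u \<alpha> g" "has_weak_deriv u \<alpha> h"
  shows "AE x in lebesgue. g x = h x"
proof -
  have li: "locally_integrable g" "locally_integrable h"
    using assms by (auto simp: has_weak_deriv_def)
  have "AE x in lebesgue. 1 *\<^sub>R g x + (- 1) *\<^sub>R h x = 0"
  proof (rule AE_zero_if_test_integrals_zero)
    show "locally_integrable (\<lambda>x. 1 *\<^sub>R g x + (- 1) *\<^sub>R h x)"
      by (intro locally_integrable_lincomb li)
    fix \<phi> :: "'a cfun" assume \<phi>: "\<phi> \<in> test_functions"
    have "(LINT x|lebesgue. u x * mderiv \<alpha> \<phi> x) = (- 1) ^ multi_order \<alpha> * (LINT x|lebesgue. g x * \<phi> x)"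
      "(LINT x|lebesgue. u x * mderiv \<alpha> \<phi> x) = (- 1) ^ multi_order \<alpha> * (LINT x|lebesgue. h x * \<phi> x)"
      using assms \<phi> by (auto simp: has_weak_deriv_def)
    then have "(LINT x|lebesgue. g x * \<phi> x) = (LINT x|lebesgue. h x * \<phi> x)"
      by simp
    then show "(LINT x|lebesgue. (1 *\<^sub>R g x + (- 1) *\<^sub>R h x) * \<phi> x) = 0"
      using integrable_mult_test_function[OF li(1) \<phi>] integrable_mult_test_function[OF li(2) \<phi>]
      by (simp add: algebra_simps)
  qed
  then show ?thesis by simp
qed

lemma has_weak_deriv_lincomb:
  assumes "has_weak_deriv u \<alpha> g" "has_weak_deriv v \<alpha> h"
  shows "has_weak_deriv (\<lambda>x. a *\<^sub>R u x + b *\<^sub>R v x) \<alpha> (\<lambda>x. a *\<^sub>R g x + b *\<^sub>R h x)"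
proof -
  have li: "locally_integrable u" "locally_integrable v" "locally_integrable g" "locally_integrable h"
    using assms by (auto simp: has_weak_deriv_def)
  have lin: "(LINT x|lebesgue. (a *\<^sub>R f1 x + b *\<^sub>R f2 x) * \<phi> x) =
      a *\<^sub>R (LINT x|lebesgue. f1 x * \<phi> x) + b *\<^sub>R (LINT x|lebesgue. f2 x * \<phi> x)"
    if "locally_integrable f1" "locally_integrable f2" "\<phi> \<in> test_functions" for f1 f2 \<phi> :: "'a cfun"
    using integrable_mult_test_function[OF that(1,3)] integrable_mult_test_function[OF that(2,3)]
    by (simp add: distrib_right)
  show ?thesis
    unfolding has_weak_deriv_def
  proof (intro conjI ballI locally_integrable_lincomb li)
    fix \<phi> :: "'a cfun" assume \<phi>: "\<phi> \<in> test_functions"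
    have eqs: "(LINT x|lebesgue. u x * mderiv \<alpha> \<phi> x) = (- 1) ^ multi_order \<alpha> * (LINT x|lebesgue. g x * \<phi> x)"
      "(LINT x|lebesgue. v x * mderiv \<alpha> \<phi> x) = (- 1) ^ multi_order \<alpha> * (LINT x|lebesgue. h x * \<phi> x)"
      using assms \<phi> by (auto simp: has_weak_deriv_def)
    show "(LINT x|lebesgue. (a *\<^sub>R u x + b *\<^sub>R v x) * mderiv \<alpha> \<phi> x) =
        (- 1) ^ multi_order \<alpha> * (LINT x|lebesgue. (a *\<^sub>R g x + b *\<^sub>R h x) * \<phi> x)"
      by (simp only: lin[OF li(1,2) test_function_mderiv[OF \<phi>]] lin[OF li(3,4) \<phi>] eqs)
        (simp add: algebra_simps)
  qed
qed

subsection \<open>Semi-inner products on spaces of functions\<close>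

text \<open>A common frame for the real L2 form and the Dirichlet form. The form is only
  semidefinite because functions represent classes modulo equality almost everywhere. Symmetry and
  nonnegativity hold on all functions since integrals and chosen weak derivatives are total.\<close>

locale semi_inner =
  fixes X :: "('a \<Rightarrow> 'b::real_vector) set"
    and B :: "('a \<Rightarrow> 'b) \<Rightarrow> ('a \<Rightarrow> 'b) \<Rightarrow> real"
  assumes lincomb: "u \<in> X \<Longrightarrow> v \<in> X \<Longrightarrow> (\<lambda>x. a *\<^sub>R u x + b *\<^sub>R v x) \<in> X"
    and sym: "B u v = B v u"
    and lin_right: "\<lbrakk>w \<in> X; u \<in> X; v \<in> X\<rbrakk> \<Longrightarrow>
      B w (\<lambda>x. a *\<^sub>R u x + b *\<^sub>R v x) = a * B w u + b * B w v"
    and nonneg: "0 \<le> B u u"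
begin

definition N :: "('a \<Rightarrow> 'b) \<Rightarrow> real" where
  "N u = sqrt (B u u)"

lemma N_nonneg: "0 \<le> N u" and N_sq: "(N u)\<^sup>2 = B u u"
  by (simp_all add: N_def nonneg)

lemma lin_left: "\<lbrakk>w \<in> X; u \<in> X; v \<in> X\<rbrakk> \<Longrightarrow>
    B (\<lambda>x. a *\<^sub>R u x + b *\<^sub>R v x) w = a * B u w + b * B v w"
  using lin_right sym by metis

lemma quadratic:
  assumes "u \<in> X" "v \<in> X"
  shows "B (\<lambda>x. a *\<^sub>R u x + b *\<^sub>R v x) (\<lambda>x. a *\<^sub>R u x + b *\<^sub>R v x) =
    a\<^sup>2 * B u u + 2 * a * b * B u v + b\<^sup>2 * B v v"
  using assms by (simp add: lin_left lin_right lincomb sym[of v u] power2_eq_square algebra_simps)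

lemma cauchy_schwarz:
  assumes u: "u \<in> X" and v: "v \<in> X"
  shows "\<bar>B u v\<bar> \<le> N u * N v"
proof -
  have q: "0 \<le> a\<^sup>2 * B u u + 2 * a * b * B u v + b\<^sup>2 * B v v" for a b
    using quadratic[OF u v, of a b] nonneg by metis
  have "(B u v)\<^sup>2 \<le> B u u * B v v"
  proof (cases "B v v = 0")
    case True
    have "B u v = 0"
    proof (rule ccontr)
      assume "B u v \<noteq> 0"
      \<comment> \<open>With \<open>B v v = 0\<close> the quadratic is affine in \<open>b\<close>;
        this \<open>b\<close> is chosen to make its value -1.\<close>
      then show False
        using q[of 1 "- (B u u + 1) / (2 * B u v)"] True by (simp add: field_simps)
    qed
    then show ?thesis by (simp add: nonneg)
  next
    case False
    then have "0 < B v v" using nonneg[of v] by linarith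
    \<comment> \<open>The choice a = B v v, b = - B u v is the minimizing ratio of the quadratic,
      cleared of denominators.\<close>
    moreover have "0 \<le> B v v * (B u u * B v v - (B u v)\<^sup>2)"
      using q[of "B v v" "- B u v"] by (simp add: power2_eq_square algebra_simps)
    ultimately show ?thesis by (simp add: zero_le_mult_iff)
  qed
  then have "sqrt ((B u v)\<^sup>2) \<le> sqrt (B u u * B v v)"
    by (rule real_sqrt_le_mono)
  then show ?thesis by (simp add: N_def real_sqrt_mult)
qed

lemma N_scale:
  assumes "u \<in> X"
  shows "N (\<lambda>x. a *\<^sub>R u x) = \<bar>a\<bar> * N u"
  using quadratic[OF assms assms, of a 0] by (simp add: N_def real_sqrt_mult)

text \<open>The cross term is written \<open>B v u\<close> so that, for fixed \<open>v\<close>, it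
  is the functional \<open>B v\<close> evaluated at \<open>u\<close>, ready for weak
  convergence.\<close>

lemma N_diff_sq:
  assumes "u \<in> X" "v \<in> X"
  shows "(N (\<lambda>x. u x - v x))\<^sup>2 = (N u)\<^sup>2 - 2 * B v u + (N v)\<^sup>2"
  using quadratic[OF assms, of 1 "- 1"] by (simp add: N_sq sym)

text \<open>Functionals bounded by the seminorm \<open>N\<close> alone. For the Dirichlet form these
  lie in \<open>sobolev_dual\<close>, since \<open>norm_D\<close> is dominated by
  \<open>norm_H\<close>.\<close>

definition dual :: "(('a \<Rightarrow> 'b) \<Rightarrow> real) set" where
  "dual = {l. (\<forall>u\<in>X. \<forall>v\<in>X. \<forall>a b. l (\<lambda>x. a *\<^sub>R u x + b *\<^sub>R v x) = a * l u + b * l v) \<and>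
     (\<exists>C. \<forall>u\<in>X. \<bar>l u\<bar> \<le> C * N u)}"

lemma inner_in_dual: "w \<in> X \<Longrightarrow> B w \<in> dual"
  using cauchy_schwarz by (auto simp: dual_def lin_right)

text \<open>The gliding hump argument: if \<open>N (e k) \<ge> 4 ^ k\<close>, then the signs \<open>s k\<close> can be chosen
  one after the other such that the functional \<open>\<Sum>k. s k / 3 ^ k * B (e k / N (e k))\<close>
  is unbounded on the sequence \<open>e\<close>. Thus neither the space nor its dual need be known
  to be complete.\<close>

lemma uniform_boundedness:
  assumes w: "\<And>n. w n \<in> X" and bdd: "\<And>l. l \<in> dual \<Longrightarrow> Bseq (\<lambda>n. l (w n))"
  shows "Bseq (\<lambda>n. N (w n))"
proof (rule ccontr)
  assume not: "\<not> Bseq (\<lambda>n. N (w n))"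
  have "\<exists>n. 4 ^ k \<le> N (w n)" for k :: nat
  proof (rule ccontr)
    assume "\<not> ?thesis"
    then have "norm (N (w n)) \<le> 4 ^ k" for n
      by (auto simp: not_le N_nonneg less_imp_le)
    then show False using not BseqI'[of "\<lambda>n. N (w n)" "4 ^ k"] by blast
  qed
  then obtain r where r: "\<And>k::nat. 4 ^ k \<le> N (w (r k))" by metis
  define e where "e k = w (r k)" for k
  have eX: "e k \<in> X" and e4: "4 ^ k \<le> N (e k)" for k by (simp_all add: e_def w r)
  have epos: "0 < N (e k)" for k
    by (rule less_le_trans[OF _ e4]) simp
  \<comment> \<open>The sign follows that of \<open>F (e k)\<close>, so the new term cannot cancel
    the earlier ones at \<open>e k\<close>. Dividing by \<open>N (e k)\<close> gives each added
    functional norm at most \<open>(1 / 3) ^ k\<close>.\<close>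
  define step where "step k F v =
    F v + (if 0 \<le> F (e k) then 1 else - 1) * (1 / 3) ^ k * (B (e k) v / N (e k))" for k F v
  define F where "F = rec_nat (\<lambda>_. 0) step"
  have F0: "F 0 v = 0" for v by (simp add: F_def)
  have FS: "F (Suc k) v = F k v +
      (if 0 \<le> F k (e k) then 1 else - 1) * (1 / 3) ^ k * (B (e k) v / N (e k))" for k v
    by (simp add: F_def step_def)
  have Flin: "F k (\<lambda>x. a *\<^sub>R u x + b *\<^sub>R v x) = a * F k u + b * F k v"
    if "u \<in> X" "v \<in> X" for k a b u v
    by (induction k) (simp_all add: F0 FS lin_right eX that algebra_simps add_divide_distrib diff_divide_distrib)
  have hump: "(1 / 3) ^ k * N (e k) \<le> \<bar>F (Suc k) (e k)\<bar>" for k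
  proof -
    have "B (e k) (e k) / N (e k) = N (e k)"
      using epos[of k] by (simp add: field_simps power2_eq_square flip: N_sq)
    then have "F (Suc k) (e k) = F k (e k) + (if 0 \<le> F k (e k) then 1 else - 1) * ((1 / 3) ^ k * N (e k))"
      by (simp add: FS)
    moreover have "0 \<le> (1 / 3) ^ k * N (e k)" by (simp add: N_nonneg)
    ultimately show ?thesis by (auto simp: abs_if)
  qed
  have incr: "\<bar>F (Suc k) v - F k v\<bar> \<le> (1 / 3) ^ k * N v" if "v \<in> X" for k v
  proof -
    have "\<bar>F (Suc k) v - F k v\<bar> = (1 / 3) ^ k * (\<bar>B (e k) v\<bar> / N (e k))"
      using epos[of k] by (simp add: FS abs_mult)
    also have "\<bar>B (e k) v\<bar> / N (e k) \<le> N v"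
      using cauchy_schwarz[OF eX that, of k] epos[of k] by (simp add: field_simps)
    finally show ?thesis by (simp add: mult_left_mono)
  qed
  \<comment> \<open>The bound is the geometric sum of \<open>(1 / 3) ^ i\<close> for
    \<open>i\<close> from \<open>k\<close> to \<open>k + j - 1\<close>, whence the factor 3 /
    2.\<close>
  have tail: "\<bar>F (k + j) v - F k v\<bar> \<le> 3 / 2 * ((1 / 3) ^ k - (1 / 3) ^ (k + j)) * N v"
    if "v \<in> X" for k j v
  proof (induction j)
    case (Suc j)
    have "\<bar>F (k + Suc j) v - F k v\<bar> \<le> \<bar>F (Suc (k + j)) v - F (k + j) v\<bar> + \<bar>F (k + j) v - F k v\<bar>"
      by simp
    also have "\<dots> \<le> (1 / 3) ^ (k + j) * N v + 3 / 2 * ((1 / 3) ^ k - (1 / 3) ^ (k + j)) * N v"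
      by (intro add_mono incr Suc.IH that)
    also have "\<dots> = 3 / 2 * ((1 / 3) ^ k - (1 / 3) ^ (k + Suc j)) * N v"
      by (simp add: algebra_simps)
    finally show ?case .
  qed simp
  have tail': "\<bar>F n v - F k v\<bar> \<le> 3 / 2 * (1 / 3) ^ k * N v" if "v \<in> X" "k \<le> n" for k n v
  proof -
    have "\<bar>F n v - F k v\<bar> \<le> 3 / 2 * ((1 / 3) ^ k - (1 / 3) ^ n) * N v"
      using tail[OF that(1), of k "n - k"] that(2) by simp
    also have "\<dots> \<le> 3 / 2 * (1 / 3) ^ k * N v"
      by (intro mult_right_mono N_nonneg) simp
    finally show ?thesis .
  qed
  define l where "l v = lim (\<lambda>k. F k v)" for v
  have lim: "(\<lambda>k. F k v) \<longlonglongrightarrow> l v" if "v \<in> X" for v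
  proof -
    have "summable (\<lambda>k. F (Suc k) v - F k v)"
      by (rule summable_comparison_test'[where g = "\<lambda>k. (1 / 3) ^ k * N v" and N = 0])
        (use incr[OF that] in \<open>auto intro!: summable_mult2 summable_geometric\<close>)
    then have "convergent (\<lambda>n. \<Sum>k<n. F (Suc k) v - F k v)"
      by (simp add: summable_iff_convergent)
    then have "convergent (\<lambda>n. F n v)"
      by (simp add: sum_lessThan_telescope[of "\<lambda>k. F k v"] F0)
    then show ?thesis by (simp add: l_def convergent_LIMSEQ_iff)
  qed
  have ltail: "\<bar>l v - F k v\<bar> \<le> 3 / 2 * (1 / 3) ^ k * N v" if "v \<in> X" for k v
    by (rule LIMSEQ_le_const2[OF tendsto_rabs[OF tendsto_diff[OF lim[OF that] tendsto_const]]])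
      (use tail'[OF that] in blast)
  have "l \<in> dual"
    unfolding dual_def
  proof (intro CollectI conjI ballI allI exI)
    fix u v a b assume uv: "u \<in> X" "v \<in> X"
    have "(\<lambda>k. F k (\<lambda>x. a *\<^sub>R u x + b *\<^sub>R v x)) \<longlonglongrightarrow> a * l u + b * l v"
      unfolding Flin[OF uv] by (intro tendsto_intros lim uv)
    then show "l (\<lambda>x. a *\<^sub>R u x + b *\<^sub>R v x) = a * l u + b * l v"
      using lim[OF lincomb[OF uv]] LIMSEQ_unique by blast
  next
    fix v assume "v \<in> X"
    then show "\<bar>l v\<bar> \<le> 3 / 2 * N v" using ltail[of v 0] by (simp add: F0)
  qed
  then obtain K where K: "\<And>n. \<bar>l (w n)\<bar> \<le> K"
    using bdd by (auto simp: Bseq_def)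
  have "(4 / 3) ^ k \<le> 2 * K" for k :: nat
  proof -
    have "(1 / 3) ^ k * N (e k) \<le> \<bar>F (Suc k) (e k)\<bar>" by (rule hump)
    also have "\<dots> \<le> \<bar>l (e k)\<bar> + \<bar>l (e k) - F (Suc k) (e k)\<bar>" by simp
    \<comment> \<open>The terms after index \<open>k\<close> contribute at most 3 / 2 * (1 / 3) ^ (k
      + 1) = 1 / 2 * (1 / 3) ^ k times \<open>N (e k)\<close>. Half of the hump survives, and it
      grows at least like \<open>(4 / 3) ^ k\<close>.\<close>
    also have "\<dots> \<le> K + 1 / 2 * ((1 / 3) ^ k * N (e k))"
      using ltail[OF eX, of k "Suc k"] K[of "r k"] by (simp add: e_def)
    finally have "(1 / 3) ^ k * N (e k) \<le> 2 * K" by simp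
    moreover have "(1 / 3) ^ k * 4 ^ k \<le> (1 / 3) ^ k * N (e k)"
      by (intro mult_left_mono e4) simp
    ultimately show ?thesis by (simp add: power_divide)
  qed
  moreover obtain k where "2 * K < (4 / 3) ^ k"
    using real_arch_pow[of "4 / 3" "2 * K"] by auto
  ultimately show False by (meson not_le)
qed

end

subsection \<open>The forms of the L2 norm and of the Dirichlet norm\<close>

text \<open>On complex numbers \<open>\<bullet>\<close> is the real part of the Hermitian product.
  The norm is unchanged and the form is real bilinear, matching the real functionals in
  \<open>sobolev_dual\<close>.\<close>

definition L2_inner :: "'n::finite cfun \<Rightarrow> 'n cfun \<Rightarrow> real" where
  "L2_inner f g = (LINT x|lebesgue. f x \<bullet> g x)"

definition D_inner :: "nat \<Rightarrow> 'n::finite cfun \<Rightarrow> 'n cfun \<Rightarrow> real" where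
  "D_inner m f g = (\<Sum>\<alpha> | multi_order \<alpha> = m. L2_inner (weak_deriv \<alpha> f) (weak_deriv \<alpha> g))"

lemma L2_integrable_inner:
  assumes "f \<in> L2" "g \<in> L2"
  shows "integrable lebesgue (\<lambda>x. f x \<bullet> g x)"
proof (rule Bochner_Integration.integrable_bound)
  show "integrable lebesgue (\<lambda>x. (cmod (f x))\<^sup>2 + (cmod (g x))\<^sup>2)"
    using assms by (auto simp: L2_def)
  show "(\<lambda>x. f x \<bullet> g x) \<in> borel_measurable lebesgue"
    using assms by (auto simp: L2_def)
  have "\<bar>y \<bullet> z\<bar> \<le> (cmod y)\<^sup>2 + (cmod z)\<^sup>2" for y z
  proof -
    have "\<bar>y \<bullet> z\<bar> \<le> cmod y * cmod z"
      by (rule Cauchy_Schwarz_ineq2)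
    moreover have "2 * (cmod y * cmod z) \<le> (cmod y)\<^sup>2 + (cmod z)\<^sup>2"
      using sum_squares_bound[of "cmod y" "cmod z"] by simp
    moreover have "0 \<le> cmod y * cmod z" by simp
    ultimately show ?thesis by linarith
  qed
  then show "AE x in lebesgue. norm (f x \<bullet> g x) \<le> norm ((cmod (f x))\<^sup>2 + (cmod (g x))\<^sup>2)"
    by (intro AE_I2) simp
qed

lemma L2_lincomb:
  assumes "f \<in> L2" "g \<in> L2"
  shows "(\<lambda>x. a *\<^sub>R f x + b *\<^sub>R g x) \<in> L2"
proof -
  have eq: "(cmod (a *\<^sub>R y + b *\<^sub>R z))\<^sup>2 =
      a\<^sup>2 * (cmod y)\<^sup>2 + 2 * a * b * (y \<bullet> z) + b\<^sup>2 * (cmod z)\<^sup>2" for y z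
    by (simp only: power2_norm_eq_inner inner_add_left inner_add_right inner_scaleR_left
        inner_scaleR_right inner_commute[of z y]) (simp only: power2_eq_square algebra_simps)
  have "integrable lebesgue (\<lambda>x. (cmod (a *\<^sub>R f x + b *\<^sub>R g x))\<^sup>2)"
    unfolding eq using assms L2_integrable_inner[OF assms]
    by (intro Bochner_Integration.integrable_add integrable_mult_right) (auto simp: L2_def)
  then show ?thesis using assms by (auto simp: L2_def)
qed

interpretation L2: semi_inner "L2 :: 'n::finite cfun set" L2_inner
  rewrites "semi_inner.N L2_inner = (norm_L2 :: 'n cfun \<Rightarrow> real)"
proof -
  show "semi_inner (L2 :: 'n cfun set) L2_inner"
  proof
    fix w u v :: "'n cfun" and a b :: real
    assume "w \<in> L2" "u \<in> L2" "v \<in> L2"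
    then show "L2_inner w (\<lambda>x. a *\<^sub>R u x + b *\<^sub>R v x) = a * L2_inner w u + b * L2_inner w v"
      by (simp add: L2_inner_def inner_add_right L2_integrable_inner)
  qed (auto simp: L2_lincomb L2_inner_def inner_commute intro: integral_nonneg_AE)
  then interpret semi_inner "L2 :: 'n cfun set" L2_inner .
  show "N = norm_L2"
    by (simp add: fun_eq_iff N_def norm_L2_def L2_inner_def power2_norm_eq_inner)
qed

text \<open>The representative picked by \<open>SOME\<close> need not be the square integrable one
  supplied by \<open>sobolev\<close>, but the two agree almost everywhere, which transfers Lebesgue
  measurability and the integral.\<close>

lemma weak_deriv_works:
  assumes "u \<in> sobolev m" "multi_order \<alpha> \<le> m"
  shows "has_weak_deriv u \<alpha> (weak_deriv \<alpha> u)" "weak_deriv \<alpha> u \<in> L2"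
proof -
  obtain g where g: "g \<in> L2" "has_weak_deriv u \<alpha> g"
    using assms unfolding sobolev_def by blast
  show w: "has_weak_deriv u \<alpha> (weak_deriv \<alpha> u)"
    unfolding weak_deriv_def by (rule someI[of "has_weak_deriv u \<alpha>", OF g(2)])
  have ae: "AE x in lebesgue. g x = weak_deriv \<alpha> u x"
    by (rule has_weak_deriv_unique[OF g(2) w])
  have meas: "weak_deriv \<alpha> u \<in> borel_measurable lebesgue"
    using borel_measurable_AE[OF _ ae] g(1) by (auto simp: L2_def)
  have "integrable lebesgue (\<lambda>x. (cmod (weak_deriv \<alpha> u x))\<^sup>2)"
    by (rule Bochner_Integration.integrable_cong_AE_imp[where g = "\<lambda>x. (cmod (g x))\<^sup>2"])
      (use g(1) meas ae in \<open>auto simp: L2_def\<close>)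
  with meas show "weak_deriv \<alpha> u \<in> L2" by (simp add: L2_def)
qed

lemma sobolev_subset_L2: "sobolev m \<subseteq> L2"
  by (auto simp: sobolev_def)

lemma sobolev_lincomb:
  assumes "u \<in> sobolev m" "v \<in> sobolev m"
  shows "(\<lambda>x. a *\<^sub>R u x + b *\<^sub>R v x) \<in> sobolev m"
  unfolding sobolev_def
proof (intro CollectI conjI allI impI)
  show "(\<lambda>x. a *\<^sub>R u x + b *\<^sub>R v x) \<in> L2"
    using assms sobolev_subset_L2 by (intro L2_lincomb) auto
  fix \<alpha> :: "'a \<Rightarrow> nat" assume \<alpha>: "multi_order \<alpha> \<le> m"
  show "\<exists>g\<in>L2. has_weak_deriv (\<lambda>x. a *\<^sub>R u x + b *\<^sub>R v x) \<alpha> g"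
    using has_weak_deriv_lincomb[OF weak_deriv_works(1)[OF assms(1) \<alpha>] weak_deriv_works(1)[OF assms(2) \<alpha>]]
      L2_lincomb[OF weak_deriv_works(2)[OF assms(1) \<alpha>] weak_deriv_works(2)[OF assms(2) \<alpha>]] ..
qed

text \<open>The three representatives are chosen independently, so linearity can only be expected
  almost everywhere; it follows from uniqueness. This suffices under the integrals of
  \<open>D_inner\<close>.\<close>

lemma weak_deriv_lincomb:
  assumes "u \<in> sobolev m" "v \<in> sobolev m" "multi_order \<alpha> \<le> m"
  shows "AE x in lebesgue. weak_deriv \<alpha> (\<lambda>x. a *\<^sub>R u x + b *\<^sub>R v x) x =
    a *\<^sub>R weak_deriv \<alpha> u x + b *\<^sub>R weak_deriv \<alpha> v x"
proof (rule has_weak_deriv_unique)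
  show "has_weak_deriv (\<lambda>x. a *\<^sub>R u x + b *\<^sub>R v x) \<alpha> (weak_deriv \<alpha> (\<lambda>x. a *\<^sub>R u x + b *\<^sub>R v x))"
    by (rule weak_deriv_works(1)[OF sobolev_lincomb[OF assms(1,2)] assms(3)])
  show "has_weak_deriv (\<lambda>x. a *\<^sub>R u x + b *\<^sub>R v x) \<alpha>
      (\<lambda>x. a *\<^sub>R weak_deriv \<alpha> u x + b *\<^sub>R weak_deriv \<alpha> v x)"
    by (rule has_weak_deriv_lincomb[OF weak_deriv_works(1)[OF assms(1,3)] weak_deriv_works(1)[OF assms(2,3)]])
qed

interpretation D: semi_inner "sobolev m :: 'n::finite cfun set" "D_inner m"
  rewrites "semi_inner.N (D_inner m) = (norm_D m :: 'n cfun \<Rightarrow> real)"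
  for m
proof -
  show "semi_inner (sobolev m :: 'n cfun set) (D_inner m)"
  proof
    fix w u v :: "'n cfun" and a b :: real
    assume *: "w \<in> sobolev m" "u \<in> sobolev m" "v \<in> sobolev m"
    have "L2_inner (weak_deriv \<alpha> w) (weak_deriv \<alpha> (\<lambda>x. a *\<^sub>R u x + b *\<^sub>R v x)) =
        a * L2_inner (weak_deriv \<alpha> w) (weak_deriv \<alpha> u)
        + b * L2_inner (weak_deriv \<alpha> w) (weak_deriv \<alpha> v)"
      if \<alpha>: "multi_order \<alpha> \<le> m" for \<alpha>
    proof -
      have L2: "weak_deriv \<alpha> w \<in> L2" "weak_deriv \<alpha> u \<in> L2" "weak_deriv \<alpha> v \<in> L2"
        "weak_deriv \<alpha> (\<lambda>x. a *\<^sub>R u x + b *\<^sub>R v x) \<in> L2"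
        using weak_deriv_works(2)[OF _ \<alpha>] * sobolev_lincomb by blast+
      have "L2_inner (weak_deriv \<alpha> w) (weak_deriv \<alpha> (\<lambda>x. a *\<^sub>R u x + b *\<^sub>R v x)) =
          L2_inner (weak_deriv \<alpha> w) (\<lambda>x. a *\<^sub>R weak_deriv \<alpha> u x + b *\<^sub>R weak_deriv \<alpha> v x)"
        unfolding L2_inner_def
      proof (rule integral_cong_AE)
        show "AE x in lebesgue. weak_deriv \<alpha> w x \<bullet> weak_deriv \<alpha> (\<lambda>x. a *\<^sub>R u x + b *\<^sub>R v x) x =
            weak_deriv \<alpha> w x \<bullet> (a *\<^sub>R weak_deriv \<alpha> u x + b *\<^sub>R weak_deriv \<alpha> v x)"
          using weak_deriv_lincomb[OF *(2,3) \<alpha>, of a b] by eventually_elim simp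
      qed (use L2 in \<open>auto simp: L2_def\<close>)
      then show ?thesis by (simp add: L2.lin_right L2)
    qed
    then show "D_inner m w (\<lambda>x. a *\<^sub>R u x + b *\<^sub>R v x) = a * D_inner m w u + b * D_inner m w v"
      by (simp add: D_inner_def sum.distrib sum_distrib_left)
  qed (auto simp: sobolev_lincomb D_inner_def L2.sym intro: sum_nonneg L2.nonneg)
  then interpret semi_inner "sobolev m :: 'n cfun set" "D_inner m" .
  show "N = norm_D m"
    by (simp add: fun_eq_iff N_def norm_D_def D_inner_def L2_inner_def power2_norm_eq_inner)
qed

section \<open>Vector operations, norms and bounded functionals on the Sobolev space\<close>

lemma sobolev_scale: "u \<in> sobolev m \<Longrightarrow> (\<lambda>x. a *\<^sub>R u x) \<in> sobolev m"
  using sobolev_lincomb[of u m u a 0] by simp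

lemma sobolev_diff: "u \<in> sobolev m \<Longrightarrow> v \<in> sobolev m \<Longrightarrow> (\<lambda>x. u x - v x) \<in> sobolev m"
  using sobolev_lincomb[of u m v 1 "- 1"] by simp

lemma norm_L2_le_norm_H: "norm_L2 u \<le> norm_H m u"
  and norm_D_le_norm_H: "norm_D m u \<le> norm_H m u"
  by (auto simp: norm_H_def intro!: real_le_rsqrt)

lemma norm_L2_scale: "u \<in> sobolev m \<Longrightarrow> norm_L2 (\<lambda>x. a *\<^sub>R u x) = \<bar>a\<bar> * norm_L2 u"
  using L2.N_scale sobolev_subset_L2 by blast

lemma norm_H_scale: "u \<in> sobolev m \<Longrightarrow> norm_H m (\<lambda>x. a *\<^sub>R u x) = \<bar>a\<bar> * norm_H m u"
  by (simp add: norm_H_def norm_L2_scale D.N_scale power_mult_distrib real_sqrt_mult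
      flip: distrib_left)

lemma sobolev_dualI:
  assumes "\<And>u v a b. u \<in> sobolev m \<Longrightarrow> v \<in> sobolev m \<Longrightarrow>
      l (\<lambda>x. a *\<^sub>R u x + b *\<^sub>R v x) = a * l u + b * l v"
    and "\<And>u. u \<in> sobolev m \<Longrightarrow> \<bar>l u\<bar> \<le> C * p u"
    and "\<And>u. 0 \<le> p u" "\<And>u. p u \<le> norm_H m u"
  shows "l \<in> sobolev_dual m"
proof -
  have "\<bar>l u\<bar> \<le> \<bar>C\<bar> * norm_H m u" if "u \<in> sobolev m" for u
  proof -
    have "C * p u \<le> \<bar>C\<bar> * p u"
      using assms(3) by (intro mult_right_mono) auto
    also have "\<dots> \<le> \<bar>C\<bar> * norm_H m u"
      using assms(4) by (intro mult_left_mono) auto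
    finally show ?thesis using assms(2)[OF that] by linarith
  qed
  then show ?thesis using assms(1) by (auto simp: sobolev_dual_def)
qed

lemma L2_inner_in_sobolev_dual:
  assumes "w \<in> L2"
  shows "L2_inner w \<in> sobolev_dual m"
proof (rule sobolev_dualI[where C = "norm_L2 w" and p = norm_L2])
  show "L2_inner w (\<lambda>x. a *\<^sub>R u x + b *\<^sub>R v x) = a * L2_inner w u + b * L2_inner w v"
    if "u \<in> sobolev m" "v \<in> sobolev m" for u v a b
    using that assms sobolev_subset_L2 by (intro L2.lin_right) auto
  show "\<bar>L2_inner w u\<bar> \<le> norm_L2 w * norm_L2 u" if "u \<in> sobolev m" for u
    using that assms sobolev_subset_L2 by (intro L2.cauchy_schwarz) auto
qed (simp_all add: L2.N_nonneg norm_L2_le_norm_H)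

lemma D_dual_subset_sobolev_dual: "D.dual m \<subseteq> (sobolev_dual m :: ('n::finite cfun \<Rightarrow> real) set)"
proof
  fix l :: "'n cfun \<Rightarrow> real" assume l: "l \<in> D.dual m"
  then obtain C where "\<And>u. u \<in> sobolev m \<Longrightarrow> \<bar>l u\<bar> \<le> C * norm_D m u"
    unfolding D.dual_def by blast
  then show "l \<in> sobolev_dual m"
    by (rule sobolev_dualI[rotated])
      (use l in \<open>auto simp: D.dual_def D.N_nonneg norm_D_le_norm_H\<close>)
qed

subsection \<open>Weak convergence and continuity\<close>

text \<open>Every functional in \<open>D.dual\<close> lies in \<open>sobolev_dual\<close>, so its
  values on the differences converge and are bounded; the uniform boundedness principle does the
  rest.\<close>

lemma weakly_converges_norm_D_bounded:
  fixes u :: "nat \<Rightarrow> 'n::finite cfun"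
  assumes "weakly_converges m u v"
  shows "Bseq (\<lambda>n. norm_D m (\<lambda>x. u n x - v x))"
proof (rule D.uniform_boundedness)
  show "(\<lambda>x. u n x - v x) \<in> sobolev m" for n
    using assms by (auto simp: weakly_converges_def intro: sobolev_diff)
  fix l :: "'n cfun \<Rightarrow> real" assume l: "l \<in> D.dual m"
  have "l (\<lambda>x. u n x - v x) = l (u n) - l v" for n
  proof -
    have "l (\<lambda>x. 1 *\<^sub>R u n x + (- 1) *\<^sub>R v x) = 1 * l (u n) + (- 1) * l v"
      using l assms unfolding D.dual_def weakly_converges_def by blast
    then show ?thesis by simp
  qed
  moreover have "(\<lambda>n. l (u n)) \<longlonglongrightarrow> l v"
    using assms l D_dual_subset_sobolev_dual by (auto simp: weakly_converges_def)
  then have "convergent (\<lambda>n. l (u n) - l v)"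
    by (rule convergentI[OF tendsto_diff[OF _ tendsto_const]])
  ultimately show "Bseq (\<lambda>n. l (\<lambda>x. u n x - v x))"
    by (simp add: convergent_imp_Bseq)
qed

text \<open>Expand the square and test weak convergence with the functional
  \<open>D_inner m v\<close>. The claim concerns a difference of squares because the norms of
  \<open>u n\<close> themselves need not converge.\<close>

lemma weakly_converges_norm_D_split:
  assumes "weakly_converges m u v"
  shows "(\<lambda>n. (norm_D m (\<lambda>x. u n x - v x))\<^sup>2 - (norm_D m (u n))\<^sup>2) \<longlonglongrightarrow> - (norm_D m v)\<^sup>2"
proof -
  have uv: "u n \<in> sobolev m" "v \<in> sobolev m" for n
    using assms by (auto simp: weakly_converges_def)
  have "(\<lambda>n. D_inner m v (u n)) \<longlonglongrightarrow> D_inner m v v"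
    using assms D.inner_in_dual[OF uv(2)] D_dual_subset_sobolev_dual
    by (auto simp: weakly_converges_def)
  then have "(\<lambda>n. - 2 * D_inner m v (u n) + (norm_D m v)\<^sup>2) \<longlonglongrightarrow> - 2 * D_inner m v v + (norm_D m v)\<^sup>2"
    by (intro tendsto_intros)
  then show ?thesis by (simp add: D.N_diff_sq[OF uv] flip: D.N_sq)
qed

lemma weakly_converges_norm_L2_split:
  assumes "weakly_converges m u v"
  shows "(\<lambda>n. (norm_L2 (\<lambda>x. u n x - v x))\<^sup>2 - (norm_L2 (u n))\<^sup>2) \<longlonglongrightarrow> - (norm_L2 v)\<^sup>2"
proof -
  have uv: "u n \<in> L2" "v \<in> L2" for n
    using assms sobolev_subset_L2 by (auto simp: weakly_converges_def)
  have "(\<lambda>n. L2_inner v (u n)) \<longlonglongrightarrow> L2_inner v v"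
    using assms L2_inner_in_sobolev_dual[OF uv(2)] by (auto simp: weakly_converges_def)
  then have "(\<lambda>n. - 2 * L2_inner v (u n) + (norm_L2 v)\<^sup>2) \<longlonglongrightarrow> - 2 * L2_inner v v + (norm_L2 v)\<^sup>2"
    by (intro tendsto_intros)
  then show ?thesis by (simp add: L2.N_diff_sq[OF uv] flip: L2.N_sq)
qed

text \<open>Differentiability at \<open>v\<close> with tolerance 1 gives
  \<open>\<bar>T w - T v\<bar> \<le> (C + 1) * norm_H m (w - v)\<close> near \<open>v\<close>, where
  \<open>C\<close> bounds the differential at \<open>v\<close>.\<close>

lemma C1_functional_continuous:
  assumes T: "C1_functional m T T'" and v: "v \<in> sobolev m" and w: "\<And>n. w n \<in> sobolev m"
    and lim: "(\<lambda>n. norm_H m (\<lambda>x. w n x - v x)) \<longlonglongrightarrow> 0"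
  shows "(\<lambda>n. T (w n)) \<longlonglongrightarrow> T v"
proof -
  let ?h = "\<lambda>n x. w n x - v x"
  have d: "has_sobolev_deriv m T (T' v) v"
    using T v by (auto simp: C1_functional_def)
  then obtain C where C: "\<And>u. u \<in> sobolev m \<Longrightarrow> \<bar>T' v u\<bar> \<le> C * norm_H m u"
    unfolding has_sobolev_deriv_def sobolev_dual_def by blast
  obtain \<delta> where "\<delta> > 0" and \<delta>: "\<And>u. u \<in> sobolev m \<Longrightarrow> norm_H m (\<lambda>x. u x - v x) < \<delta> \<Longrightarrow>
      \<bar>T u - T v - T' v (\<lambda>x. u x - v x)\<bar> \<le> 1 * norm_H m (\<lambda>x. u x - v x)"
    using d zero_less_one unfolding has_sobolev_deriv_def by blast
  have "\<forall>\<^sub>F n in sequentially. norm_H m (?h n) < \<delta>"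
    using order_tendstoD(2)[OF lim \<open>\<delta> > 0\<close>] .
  then have "\<forall>\<^sub>F n in sequentially. norm (T (w n) - T v) \<le> norm_H m (?h n) * (C + 1)"
  proof eventually_elim
    case (elim n)
    then show ?case
      using \<delta>[OF w elim] C[OF sobolev_diff[OF w v], of n] by (simp add: algebra_simps)
  qed
  then have "(\<lambda>n. T (w n) - T v) \<longlonglongrightarrow> 0"
    by (rule Lim_null_comparison) (rule tendsto_mult_left_zero[OF lim])
  then show ?thesis by (rule LIM_zero_cancel)
qed

lemma energy_scale_tendsto:
  assumes T: "C1_functional m T T'" and w: "w \<in> sobolev m" and s: "s \<longlonglongrightarrow> s0"
  shows "(\<lambda>n. energy m T (\<lambda>x. s n *\<^sub>R w x)) \<longlonglongrightarrow> energy m T (\<lambda>x. s0 *\<^sub>R w x)"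
proof -
  have "(\<lambda>n. T (\<lambda>x. s n *\<^sub>R w x)) \<longlonglongrightarrow> T (\<lambda>x. s0 *\<^sub>R w x)"
  proof (rule C1_functional_continuous[OF T])
    have "(\<lambda>n. \<bar>s n - s0\<bar> * norm_H m w) \<longlonglongrightarrow> \<bar>s0 - s0\<bar> * norm_H m w"
      by (intro tendsto_intros s)
    then show "(\<lambda>n. norm_H m (\<lambda>x. s n *\<^sub>R w x - s0 *\<^sub>R w x)) \<longlonglongrightarrow> 0"
      using norm_H_scale[OF w] by (simp flip: scaleR_diff_left)
  qed (use w sobolev_scale in auto)
  then show ?thesis
    unfolding energy_def D.N_scale[OF w] by (intro tendsto_intros s)
qed

section \<open>Positivity of the L2 norm and competitors on L2 spheres\<close>

lemma norm_L2_pos: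
  assumes "u \<in> L2" "\<not> (AE x in lebesgue. u x = 0)"
  shows "0 < norm_L2 u"
proof -
  have "(LINT x|lebesgue. (cmod (u x))\<^sup>2) \<noteq> 0"
    using assms by (subst integral_nonneg_eq_0_iff_AE) (auto simp: L2_def)
  moreover have "0 \<le> (LINT x|lebesgue. (cmod (u x))\<^sup>2)" by simp
  ultimately show ?thesis by (simp add: norm_L2_def less_le)
qed

lemma inf_energy_le:
  "u \<in> L2_sphere m r \<Longrightarrow> inf_energy m T r \<le> ereal (energy m T u)"
  unfolding inf_energy_def by (rule INF_lower)

lemma scale_in_L2_sphere:
  "u \<in> sobolev m \<Longrightarrow> 0 \<le> a \<Longrightarrow> a * norm_L2 u = r \<Longrightarrow> (\<lambda>x. a *\<^sub>R u x) \<in> L2_sphere m r"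
  by (simp add: L2_sphere_def sobolev_scale norm_L2_scale)

subsection \<open>Minimizing sequences\<close>

text \<open>The weak limit and the rescaled remainder are competitors on the two smaller spheres,
  and their energies add up to that of \<open>u n\<close> in the limit. This is the inequality that
  strict subadditivity forbids.\<close>

lemma dichotomy_upper_bound:
  assumes min: "minimizing_sequence m T \<rho> u"
    and weak: "weakly_converges m u v"
    and less: "norm_L2 v < \<rho>"
    and split: "(\<lambda>n. T (\<lambda>x. u n x - v x) + T v - T (u n)) \<longlonglongrightarrow> 0"
    and \<alpha>: "\<And>n. \<alpha> n = sqrt (\<rho>\<^sup>2 - (norm_L2 v)\<^sup>2) / norm_L2 (\<lambda>x. u n x - v x)"
    and rescale: "(\<lambda>n. T (\<lambda>x. \<alpha> n *\<^sub>R (u n x - v x)) - T (\<lambda>x. u n x - v x)) \<longlonglongrightarrow> 0"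
  shows "inf_energy m T (norm_L2 v) + inf_energy m T (sqrt (\<rho>\<^sup>2 - (norm_L2 v)\<^sup>2)) \<le> inf_energy m T \<rho>"
proof -
  define \<sigma> where "\<sigma> = sqrt (\<rho>\<^sup>2 - (norm_L2 v)\<^sup>2)"
  let ?z = "\<lambda>n x. u n x - v x"
  let ?az = "\<lambda>n x. \<alpha> n *\<^sub>R (u n x - v x)"
  have v: "v \<in> sobolev m" and u: "u n \<in> sobolev m" "norm_L2 (u n) = \<rho>" for n
    using weak min by (auto simp: weakly_converges_def minimizing_sequence_def L2_sphere_def)
  have z: "?z n \<in> sobolev m" for n using sobolev_diff[OF u(1) v] .
  have "0 < \<sigma>"
    using less power_strict_mono[OF less L2.N_nonneg, of 2] by (simp add: \<sigma>_def)
  have "(\<lambda>n. sqrt (((norm_L2 (?z n))\<^sup>2 - (norm_L2 (u n))\<^sup>2) + \<rho>\<^sup>2)) \<longlonglongrightarrow> sqrt (- (norm_L2 v)\<^sup>2 + \<rho>\<^sup>2)"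
    by (intro tendsto_intros weakly_converges_norm_L2_split[OF weak])
  then have zlim: "(\<lambda>n. norm_L2 (?z n)) \<longlonglongrightarrow> \<sigma>"
    by (simp add: u \<sigma>_def L2.N_nonneg)
  have "(\<lambda>n. \<sigma> / norm_L2 (?z n)) \<longlonglongrightarrow> \<sigma> / \<sigma>"
    using \<open>0 < \<sigma>\<close> by (intro tendsto_intros zlim) simp
  then have \<alpha>lim: "\<alpha> \<longlonglongrightarrow> 1"
    using \<open>0 < \<sigma>\<close> by (simp add: \<alpha>[abs_def] \<sigma>_def)
  have "(\<lambda>n. 1 - (\<alpha> n)\<^sup>2) \<longlonglongrightarrow> 1 - 1\<^sup>2"
    by (intro tendsto_intros \<alpha>lim)
  then have "Zfun (\<lambda>n. 1 - (\<alpha> n)\<^sup>2) sequentially"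
    by (simp add: tendsto_Zfun_iff)
  moreover have "Bseq (\<lambda>n. norm_D m (?z n) * norm_D m (?z n))"
    by (intro Bseq_mult weakly_converges_norm_D_bounded weak)
  \<comment> \<open>The seminorms of the remainders need not converge; a null factor times a bounded
    sequence is enough.\<close>
  ultimately have "Zfun (\<lambda>n. (1 - (\<alpha> n)\<^sup>2) * (norm_D m (?z n) * norm_D m (?z n))) sequentially"
    by (rule bounded_bilinear.Zfun_prod_Bfun[OF bounded_bilinear_mult])
  then have Dlim: "(\<lambda>n. (1 - (\<alpha> n)\<^sup>2) * (norm_D m (?z n))\<^sup>2) \<longlonglongrightarrow> 0"
    by (simp add: tendsto_Zfun_iff power2_eq_square)
  have az: "(norm_D m (?az n))\<^sup>2 = (\<alpha> n)\<^sup>2 * (norm_D m (?z n))\<^sup>2" for n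
    by (subst D.N_scale[OF z]) (simp add: power_mult_distrib)
  \<comment> \<open>The energy defect of the splitting. It is written below as a combination of null
    sequences: the Dirichlet splitting, the rescaling of the seminorm, and the two hypotheses on
    \<open>T\<close>.\<close>
  define E where "E n = energy m T (u n) - energy m T (?az n) - energy m T v" for n
  have "(\<lambda>n. - (1 / 2) * (((norm_D m (?z n))\<^sup>2 - (norm_D m (u n))\<^sup>2) + (norm_D m v)\<^sup>2)
      + 1 / 2 * ((1 - (\<alpha> n)\<^sup>2) * (norm_D m (?z n))\<^sup>2)
      - (T (?z n) + T v - T (u n)) - (T (?az n) - T (?z n)))
    \<longlonglongrightarrow> - (1 / 2) * (- (norm_D m v)\<^sup>2 + (norm_D m v)\<^sup>2) + 1 / 2 * 0 - 0 - 0"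
    by (intro tendsto_intros weakly_converges_norm_D_split[OF weak] Dlim split rescale)
  moreover have "E n = - (1 / 2) * (((norm_D m (?z n))\<^sup>2 - (norm_D m (u n))\<^sup>2) + (norm_D m v)\<^sup>2)
      + 1 / 2 * ((1 - (\<alpha> n)\<^sup>2) * (norm_D m (?z n))\<^sup>2)
      - (T (?z n) + T v - T (u n)) - (T (?az n) - T (?z n))" for n
    unfolding E_def energy_def az by (simp add: algebra_simps add_divide_distrib diff_divide_distrib)
  ultimately have "E \<longlonglongrightarrow> 0" by (simp add: E_def[abs_def])
  \<comment> \<open>The limit is taken in the extended reals since the infimum could be minus
    infinity; subtracting the finite \<open>E n\<close> is harmless.\<close>
  then have "(\<lambda>n. ereal (energy m T (u n)) - ereal (E n)) \<longlonglongrightarrow> inf_energy m T \<rho> - ereal 0"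
    using min by (intro tendsto_diff_ereal_general) (auto simp: minimizing_sequence_def)
  then have lim: "(\<lambda>n. ereal (energy m T (u n)) - ereal (E n)) \<longlonglongrightarrow> inf_energy m T \<rho>"
    by (simp flip: zero_ereal_def)
  have "\<forall>\<^sub>F n in sequentially. 0 < norm_L2 (?z n)"
    using order_tendstoD(1)[OF zlim \<open>0 < \<sigma>\<close>] .
  then have "\<forall>\<^sub>F n in sequentially. inf_energy m T (norm_L2 v) + inf_energy m T \<sigma>
      \<le> ereal (energy m T (u n)) - ereal (E n)"
  proof eventually_elim
    case (elim n)
    \<comment> \<open>Positivity of the denominator is essential: division by zero would give
      \<open>\<alpha> n = 0\<close> and miss the sphere of radius \<open>\<sigma>\<close>.\<close>
    have "?az n \<in> L2_sphere m \<sigma>"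
      using elim \<open>0 < \<sigma>\<close> by (intro scale_in_L2_sphere z) (auto simp: \<alpha> simp flip: \<sigma>_def)
    moreover have "v \<in> L2_sphere m (norm_L2 v)"
      using v by (simp add: L2_sphere_def)
    ultimately have "inf_energy m T (norm_L2 v) + inf_energy m T \<sigma>
        \<le> ereal (energy m T v) + ereal (energy m T (?az n))"
      by (intro add_mono inf_energy_le)
    also have "\<dots> = ereal (energy m T (u n)) - ereal (E n)"
      by (simp add: E_def)
    finally show ?case .
  qed
  then show ?thesis
    unfolding \<sigma>_def by (rule tendsto_lowerbound[OF lim]) simp
qed

text \<open>Subadditivity is given only for radii strictly between 0 and \<open>\<rho>\<close>.
  Splitting \<open>v\<close> into two multiples of itself and shrinking one of them extends it to
  the endpoint, where continuity of the energy along the ray leaves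
  \<open>T (\<lambda>x. 0)\<close>.\<close>

lemma inf_energy_le_zero_plus:
  fixes v :: "'n::finite cfun"
  assumes T: "C1_functional m T T'" and v: "v \<in> L2_sphere m \<rho>" and \<rho>: "0 < \<rho>"
    and sub: "\<And>\<mu>. 0 < \<mu> \<Longrightarrow> \<mu> < \<rho> \<Longrightarrow>
      inf_energy m T \<rho> \<le> inf_energy m T \<mu> + inf_energy m T (sqrt (\<rho>\<^sup>2 - \<mu>\<^sup>2))"
  shows "inf_energy m T \<rho> \<le> ereal (T (\<lambda>x. 0) + energy m T v)"
proof -
  \<comment> \<open>The double successor keeps \<open>s n\<close> strictly below 1, so that the
    radius \<open>s n * \<rho>\<close> is admissible in \<open>sub\<close>.\<close>
  define s where "s n = inverse (real (Suc (Suc n)))" for n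
  have s01: "0 < s n" "s n < 1" for n
    by (simp_all add: s_def inverse_eq_divide)
  have s0: "s \<longlonglongrightarrow> 0"
    unfolding s_def by (rule LIMSEQ_Suc[OF LIMSEQ_inverse_real_of_nat])
  have v': "v \<in> sobolev m" "norm_L2 v = \<rho>" using v by (auto simp: L2_sphere_def)
  define c where "c n = sqrt (1 - (s n)\<^sup>2)" for n
  have "c \<longlonglongrightarrow> sqrt (1 - 0\<^sup>2)"
    unfolding c_def by (intro tendsto_intros s0)
  then have c1: "c \<longlonglongrightarrow> 1" by simp
  have le: "inf_energy m T \<rho> \<le>
      ereal (energy m T (\<lambda>x. s n *\<^sub>R v x) + energy m T (\<lambda>x. c n *\<^sub>R v x))" for n
  proof -
    have "sqrt (\<rho>\<^sup>2 - (s n * \<rho>)\<^sup>2) = sqrt ((1 - (s n)\<^sup>2) * \<rho>\<^sup>2)"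
      by (simp add: power_mult_distrib algebra_simps)
    also have "\<dots> = c n * \<rho>" using \<rho> by (simp add: c_def real_sqrt_mult)
    finally have eq: "sqrt (\<rho>\<^sup>2 - (s n * \<rho>)\<^sup>2) = c n * \<rho>" .
    have "0 \<le> c n"
      using s01[of n] by (simp add: c_def power_le_one)
    then have "inf_energy m T (s n * \<rho>) + inf_energy m T (c n * \<rho>) \<le>
        ereal (energy m T (\<lambda>x. s n *\<^sub>R v x)) + ereal (energy m T (\<lambda>x. c n *\<^sub>R v x))"
      using s01[of n] v' by (intro add_mono inf_energy_le scale_in_L2_sphere) auto
    moreover have "inf_energy m T \<rho> \<le> inf_energy m T (s n * \<rho>) + inf_energy m T (c n * \<rho>)"
      using sub[of "s n * \<rho>"] s01[of n] \<rho> by (simp add: eq)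
    ultimately show ?thesis by simp
  qed
  have "(\<lambda>n. ereal (energy m T (\<lambda>x. s n *\<^sub>R v x) + energy m T (\<lambda>x. c n *\<^sub>R v x)))
      \<longlonglongrightarrow> ereal (energy m T (\<lambda>x. 0 *\<^sub>R v x) + energy m T (\<lambda>x. 1 *\<^sub>R v x))"
    by (intro tendsto_ereal tendsto_add energy_scale_tendsto[OF T v'(1)] s0 c1)
  moreover have "energy m T (\<lambda>x. 0 *\<^sub>R v x) = T (\<lambda>x. 0)"
    using D.N_scale[OF v'(1), of 0] by (simp add: energy_def)
  ultimately show ?thesis
    using le LIMSEQ_le_const[of _ "ereal (T (\<lambda>x. 0) + energy m T v)"] by (simp del: lim_ereal)
qed

text \<open>The L2 part vanishes because the weak limit carries the full norm. For the Dirichlet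
  part, the energies tend to the infimum, which is at most
  \<open>T (\<lambda>x. 0) + energy m T v\<close>, leaving no room for a positive seminorm of the
  remainder.\<close>

lemma strong_convergence:
  assumes T: "C1_functional m T T'" and \<rho>: "0 < \<rho>"
    and min: "minimizing_sequence m T \<rho> u"
    and weak: "weakly_converges m u v"
    and v: "norm_L2 v = \<rho>"
    and split: "(\<lambda>n. T (\<lambda>x. u n x - v x) + T v - T (u n)) \<longlonglongrightarrow> 0"
    and vanish: "(\<lambda>n. T (\<lambda>x. 0) - T (\<lambda>x. u n x - v x)) \<longlonglongrightarrow> 0"
    and sub: "\<And>\<mu>. 0 < \<mu> \<Longrightarrow> \<mu> < \<rho> \<Longrightarrow>
      inf_energy m T \<rho> \<le> inf_energy m T \<mu> + inf_energy m T (sqrt (\<rho>\<^sup>2 - \<mu>\<^sup>2))"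
  shows "(\<lambda>n. norm_H m (\<lambda>x. u n x - v x)) \<longlonglongrightarrow> 0"
proof -
  let ?z = "\<lambda>n x. u n x - v x"
  have vs: "v \<in> sobolev m" and u: "u n \<in> sobolev m" "norm_L2 (u n) = \<rho>" for n
    using weak min by (auto simp: weakly_converges_def minimizing_sequence_def L2_sphere_def)
  have "(\<lambda>n. ((norm_L2 (?z n))\<^sup>2 - (norm_L2 (u n))\<^sup>2) + \<rho>\<^sup>2) \<longlonglongrightarrow> - (norm_L2 v)\<^sup>2 + \<rho>\<^sup>2"
    by (intro tendsto_intros weakly_converges_norm_L2_split[OF weak])
  then have L2lim: "(\<lambda>n. (norm_L2 (?z n))\<^sup>2) \<longlonglongrightarrow> 0" by (simp add: u v)
  define r where "r = T (\<lambda>x. 0) + energy m T v"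
  define \<delta> where "\<delta> n = energy m T (u n) - 1 / 2 * (norm_D m (?z n))\<^sup>2 - r" for n
  have "(\<lambda>n. - (1 / 2) * (((norm_D m (?z n))\<^sup>2 - (norm_D m (u n))\<^sup>2) + (norm_D m v)\<^sup>2)
      - (T (?z n) + T v - T (u n)) - (T (\<lambda>x. 0) - T (?z n)))
    \<longlonglongrightarrow> - (1 / 2) * (- (norm_D m v)\<^sup>2 + (norm_D m v)\<^sup>2) - 0 - 0"
    by (intro tendsto_intros weakly_converges_norm_D_split[OF weak] split vanish)
  moreover have "\<delta> n = - (1 / 2) * (((norm_D m (?z n))\<^sup>2 - (norm_D m (u n))\<^sup>2) + (norm_D m v)\<^sup>2)
      - (T (?z n) + T v - T (u n)) - (T (\<lambda>x. 0) - T (?z n))" for n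
    by (simp add: \<delta>_def r_def energy_def algebra_simps add_divide_distrib diff_divide_distrib)
  ultimately have \<delta>0: "\<delta> \<longlonglongrightarrow> 0" by (simp add: \<delta>_def[abs_def])
  have "inf_energy m T \<rho> \<le> ereal r"
    unfolding r_def by (rule inf_energy_le_zero_plus[OF T _ \<rho> sub]) (use vs v in \<open>auto simp: L2_sphere_def\<close>)
  have Dlim: "(\<lambda>n. (norm_D m (?z n))\<^sup>2) \<longlonglongrightarrow> 0"
  proof (rule order_tendstoI)
    fix e :: real assume "0 < e"
    \<comment> \<open>Half the squared seminorm equals
      \<open>energy m T (u n) - r - \<delta> n\<close>; two errors below \<open>e / 4\<close> bound
      it by \<open>e / 2\<close>. Only an upper bound on the energy enters, so an infimum of minus
      infinity need not be excluded first.\<close>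
    have "inf_energy m T \<rho> < ereal (r + e / 4)"
      using \<open>inf_energy m T \<rho> \<le> ereal r\<close> \<open>0 < e\<close> by (simp add: le_less_trans)
    then have "\<forall>\<^sub>F n in sequentially. ereal (energy m T (u n)) < ereal (r + e / 4)"
      using min order_tendstoD(2) unfolding minimizing_sequence_def by blast
    moreover have "\<forall>\<^sub>F n in sequentially. - e / 4 < \<delta> n"
      using \<open>0 < e\<close> by (intro order_tendstoD(1)[OF \<delta>0]) simp
    ultimately show "\<forall>\<^sub>F n in sequentially. (norm_D m (?z n))\<^sup>2 < e"
      by eventually_elim (simp add: \<delta>_def)
  qed (auto intro!: always_eventually elim: less_le_trans)
  have "(\<lambda>n. sqrt ((norm_D m (?z n))\<^sup>2 + (norm_L2 (?z n))\<^sup>2)) \<longlonglongrightarrow> sqrt (0 + 0)"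
    by (intro tendsto_intros Dlim L2lim)
  then show ?thesis by (simp add: norm_H_def)
qed

theorem lemma2p1:
  fixes T :: "(real ^ 'n::finite \<Rightarrow> complex) \<Rightarrow> real"
    and T' :: "(real ^ 'n \<Rightarrow> complex) \<Rightarrow> (real ^ 'n \<Rightarrow> complex) \<Rightarrow> real"
    and m :: nat
    and \<rho> \<mu> :: real
    and u :: "nat \<Rightarrow> real ^ 'n \<Rightarrow> complex"
    and ubar :: "real ^ 'n \<Rightarrow> complex"
    and \<alpha> :: "nat \<Rightarrow> real"
  assumes "CARD('n) \<ge> 3"
    and "m \<ge> 1"
    and "C1_functional m T T'"
    and "\<rho> > 0"
    and "minimizing_sequence m T \<rho> u"
    and "weakly_converges m u ubar"
    and "\<not> (AE x in lebesgue. ubar x = 0)"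
    and "\<mu> = norm_L2 ubar"
    and "(\<lambda>n. T (\<lambda>x. u n x - ubar x) + T ubar - T (u n)) \<longlonglongrightarrow> 0"
    and "\<And>n. \<alpha> n = sqrt (\<rho>\<^sup>2 - \<mu>\<^sup>2) / norm_L2 (\<lambda>x. u n x - ubar x)"
    and "(\<lambda>n. T (\<lambda>x. \<alpha> n *\<^sub>R (u n x - ubar x)) - T (\<lambda>x. u n x - ubar x)) \<longlonglongrightarrow> 0"
    and "\<And>\<mu>'. 0 < \<mu>' \<Longrightarrow> \<mu>' < \<rho> \<Longrightarrow>
           inf_energy m T \<rho> < inf_energy m T \<mu>' + inf_energy m T (sqrt (\<rho>\<^sup>2 - \<mu>'\<^sup>2))"
  shows "ubar \<in> L2_sphere m \<rho> \<and>
    (((\<lambda>(n, k). T' (u n) (\<lambda>x. u n x - u k x) - T' (u k) (\<lambda>x. u n x - u k x)) \<longlongrightarrow> 0)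
         (sequentially \<times>\<^sub>F sequentially) \<longrightarrow>
     Bseq (\<lambda>n. T' (u n) (u n)) \<longrightarrow>
     (\<lambda>n. norm_H m (\<lambda>x. u n x - ubar x)) \<longlonglongrightarrow> 0)"
proof -
  note T = assms(3) and \<rho> = assms(4) and min = assms(5) and weak = assms(6) and \<mu> = assms(8)
    and split = assms(9) and \<alpha> = assms(10) and rescale = assms(11) and sub = assms(12)
  have ubar: "ubar \<in> sobolev m" using weak by (simp add: weakly_converges_def)
  have u: "norm_L2 (u n) = \<rho>" for n
    using min by (auto simp: minimizing_sequence_def L2_sphere_def)
  have "0 < \<mu>"
    unfolding \<mu> using ubar sobolev_subset_L2 assms(7) by (intro norm_L2_pos) auto
  have "(\<lambda>n. ((norm_L2 (\<lambda>x. u n x - ubar x))\<^sup>2 - (norm_L2 (u n))\<^sup>2) + \<rho>\<^sup>2) \<longlonglongrightarrow> - (norm_L2 ubar)\<^sup>2 + \<rho>\<^sup>2"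
    by (intro tendsto_intros weakly_converges_norm_L2_split[OF weak])
  \<comment> \<open>Since every \<open>u n\<close> has norm \<open>\<rho>\<close>, the sequence
    consists of the squared norms of the remainders, so its limit is nonnegative.\<close>
  then have "0 \<le> - (norm_L2 ubar)\<^sup>2 + \<rho>\<^sup>2"
    by (rule tendsto_lowerbound) (simp_all add: u)
  then have "\<mu>\<^sup>2 \<le> \<rho>\<^sup>2" by (simp add: \<mu>)
  then have "\<mu> \<le> \<rho>"
    by (rule power2_le_imp_le) (use \<rho> in simp)
  moreover have "\<not> \<mu> < \<rho>"
  proof
    assume "\<mu> < \<rho>"
    then have "inf_energy m T \<mu> + inf_energy m T (sqrt (\<rho>\<^sup>2 - \<mu>\<^sup>2)) \<le> inf_energy m T \<rho>"
      unfolding \<mu> using \<alpha> by (intro dichotomy_upper_bound[OF min weak _ split _ rescale]) (simp_all add: \<mu>)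
    then show False using sub[OF \<open>0 < \<mu>\<close> \<open>\<mu> < \<rho>\<close>] by simp
  qed
  ultimately have "\<mu> = \<rho>" by simp
  \<comment> \<open>For \<open>\<mu> = \<rho>\<close> the numerator of \<open>\<alpha> n\<close> is
    0, so \<open>\<alpha> n = 0\<close> whatever the denominator, even when the remainder has norm
    0.\<close>
  then have "(\<lambda>n. T (\<lambda>x. 0) - T (\<lambda>x. u n x - ubar x)) \<longlonglongrightarrow> 0"
    using rescale by (simp add: \<alpha>)
  then have "(\<lambda>n. norm_H m (\<lambda>x. u n x - ubar x)) \<longlonglongrightarrow> 0"
    using \<open>\<mu> = \<rho>\<close> \<mu> sub by (intro strong_convergence[OF T \<rho> min weak _ split]) (auto intro: less_imp_le)
  moreover have "ubar \<in> L2_sphere m \<rho>"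
    using ubar \<open>\<mu> = \<rho>\<close> \<mu> by (simp add: L2_sphere_def)
  ultimately show ?thesis by simp
qed

end
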